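(* Let $E$ be a complex Banach space, let $C\in L(E)$ be injective, let $\mathcal{G}$ be a $C$-distribution semigroup in $E$ with generator $A$, and let $\tilde{E}$ be a linear subspace of $Z(A)$ such that $\mathcal{G}$ is $\tilde{E}$-almost periodic. For $x\in Z(A)$ and $t\ge 0$ put $T(t)x:=T_x(t):=G(\delta_t)x$. For $x\in\tilde{E}$ and $t\in\mathbb{R}$ put $S(t)x:=[F(T_x(\cdot))](t)$, where $F$ maps an almost periodic function on $[0,\infty)$ to its unique continuous almost periodic extension to $\mathbb{R}$. Then: (i) $T(t)T(s)x=T(t+s)x$ for all $t\ge0$, $s\ge0$ and $x\in Z(A)$. (ii) If $t\ge 0$, $s\le 0$, $x\in\tilde{E}$ and $G(\delta_t)x\in\tilde{E}$, then $S(s)S(t)x=S(t+s)x$. (iii) If $t\ge0$, $s\le0$ and $x\in\tilde{E}$, then $S(s)x\in Z(A)$ and $T(t)S(s)x=S(t+s)x$. (iv) If $t\ge0$, $s\le0$, $x\in\tilde{E}$, $G(\delta_r)x\in\tilde{E}$ for all $r\ge0$, and $\tilde{E}$ is closed in $E$, then $S(s)x\in\tilde{E}$ and $S(t)S(s)x=S(t+s)x$. (v) If $t\le0$, $s\le0$, $x\in\tilde{E}$, $G(\delta_r)x\in\tilde{E}$ for all $r\ge0$, and $\tilde{E}$ is closed in $E$, then $S(t)S(s)x=S(t+s)x$.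
   Context: **Test functions and distributions.** $E$ is a complex Banach space, $L(E)$ the bounded linear operators on $E$, $C\in L(E)$ is injective. $\mathcal{D}=C_0^\infty(\mathbb{R})$ with its usual inductive limit topology; $\mathcal{D}_0$ is the set of $\varphi\in\mathcal{D}$ with $\mathrm{supp}(\varphi)\subseteq[0,\infty)$. $\mathcal{D}'_0(L(E))$ is the space of continuous linear maps $\mathcal{D}\to L(E)$ with support in $[0,\infty)$. For $\varphi,\psi\in\mathcal{D}$, $(\varphi*_0\psi)(t):=\int_0^t\varphi(t-s)\psi(s)\,ds$, $t\in\mathbb{R}$. **$C$-distribution semigroups.** $\mathcal{G}\in\mathcal{D}_0'(L(E))$ with $C\mathcal{G}(\varphi)=\mathcal{G}(\varphi)C$ for all $\varphi\in\mathcal{D}$ is a $C$-distribution semigroup iff (a) $\mathcal{G}(\varphi*_0\psi)C=\mathcal{G}(\varphi)\mathcal{G}(\psi)$ for all $\varphi,\psi\in\mathcal{D}$, and (b) $\bigcap_{\varphi\in\mathcal{D}_0}N(\mathcal{G}(\varphi))=\{0\}$. For a scalar distribution $T$ with compact support contained in $[0,\infty)$, $G(T)$ is the closed linear operator with graph $$G(T):=\{(x,y)\in E\times E:\ \mathcal{G}(T*\varphi)x=\mathcal{G}(\varphi)y\ \text{ for all }\varphi\in\mathcal{D}_0\}.$$ In particular $G(\delta_t)$, $t\ge0$, is defined using $\delta_t*\varphi=\varphi(\cdot-t)$. The generator of $\mathcal{G}$ is $A:=G(-\delta')$, i.e. $(x,y)\in A$ iff $\mathcal{G}(-\varphi')x=\mathcal{G}(\varphi)y$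 for all $\varphi\in\mathcal{D}_0$. **Solution space $Z(A)$.** $Z(A)$ is the set of $x\in E$ for which there is $u(\cdot,x)\in C([0,\infty):E)$ with $\int_0^tu(s,x)\,ds\in D(A)$ and $A\int_0^tu(s,x)\,ds=u(t,x)-x$ for all $t\ge0$. For the generator $A$ of $\mathcal{G}$, it is known that $Z(A)$ is the set of all $x\in\bigcap_{t\ge0}D(G(\delta_t))$ for which $t\mapsto G(\delta_t)x$, $t\ge 0$, is continuous, and $u(t,x)=G(\delta_t)x$ for $x\in Z(A)$. Also $G(\delta_t)(Z(A))\subseteq Z(A)$ for $t\ge0$. **Almost periodicity.** Let $I=\mathbb{R}$ or $I=[0,\infty)$. A continuous function $f:I\to E$ is almost periodic iff for each $\epsilon>0$ there is $l>0$ such that every subinterval of $I$ of length $l$ contains some $\tau$ with $\|f(t+\tau)-f(t)\|\le\epsilon$ for all $t\in I$. $AP(I:E)$ is the Banach space (sup-norm) of all such functions. It is known (Bart–Goldberg) that every $f\in AP([0,\infty):E)$ has a unique continuous almost periodic extension $Ff\in AP(\mathbb{R}:E)$ and that $F:AP([0,\infty):E)\to AP(\mathbb{R}:E)$ is a linear surjective isometry. For a linear subspace $\tilde E$ of $Z(A)$, $\mathcal{G}$ is $\tilde E$-almost periodic iff for each $x\in\tilde E$ the mapping $t\mapsto G(\delta_t)x$, $t\ge0$, is almost periodic. *)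

theory Defs
  imports "HOL-Analysis.Analysis"
begin

section \<open>Complex Banach spaces\<close>

class cbanach = banach +
  fixes scaleC :: "complex \<Rightarrow> 'a \<Rightarrow> 'a"  (infixr \<open>*\<^sub>C\<close> 75)
  assumes scaleC_add_right: "a *\<^sub>C (x + y) = a *\<^sub>C x + a *\<^sub>C y"
    and scaleC_add_left: "(a + b) *\<^sub>C x = a *\<^sub>C x + b *\<^sub>C x"
    and scaleC_scaleC: "a *\<^sub>C b *\<^sub>C x = (a * b) *\<^sub>C x"
    and scaleR_scaleC: "r *\<^sub>R x = complex_of_real r *\<^sub>C x"
    and norm_scaleC: "norm (a *\<^sub>C x) = cmod a * norm x"

instantiation complex :: cbanach
begin

definition scaleC_complex_def: "a *\<^sub>C (x::complex) = a * x"

instance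
  by standard (simp_all add: scaleC_complex_def algebra_simps norm_mult scaleR_conv_of_real)

end

definition csubspace :: "'a::cbanach set \<Rightarrow> bool" where
  "csubspace V \<longleftrightarrow> 0 \<in> V \<and> (\<forall>x\<in>V. \<forall>y\<in>V. x + y \<in> V) \<and> (\<forall>a. \<forall>x\<in>V. a *\<^sub>C x \<in> V)"

text \<open>The space $L(E)$: the type of real-linear bounded operators carries the operator norm,
  and complex linearity is imposed on top of it.\<close>

definition clinear_ops :: "('a::cbanach \<Rightarrow>\<^sub>L 'a) set" where
  "clinear_ops = {B. \<forall>a x. blinfun_apply B (a *\<^sub>C x) = a *\<^sub>C blinfun_apply B x}"


section \<open>Test functions\<close>

definition derivative :: "(real \<Rightarrow> complex) \<Rightarrow> real \<Rightarrow> complex" where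
  "derivative \<phi> = (\<lambda>t. vector_derivative \<phi> (at t))"

definition smooth :: "(real \<Rightarrow> complex) \<Rightarrow> bool" where
  "smooth \<phi> \<longleftrightarrow> (\<forall>n t. (derivative ^^ n) \<phi> differentiable at t)"

definition supp :: "(real \<Rightarrow> complex) \<Rightarrow> real set" where
  "supp \<phi> = closure {t. \<phi> t \<noteq> 0}"

definition test_functions :: "(real \<Rightarrow> complex) set"  (\<open>\<D>\<close>) where
  "\<D> = {\<phi>. smooth \<phi> \<and> compact (supp \<phi>)}"

definition test_functions_0 :: "(real \<Rightarrow> complex) set"  (\<open>\<D>\<^sub>0\<close>) where
  "\<D>\<^sub>0 = {\<phi> \<in> \<D>. supp \<phi> \<subseteq> {0..}}"

text \<open>The inductive limit topology on $\mathcal{D}$ is the finest locally convex topology for which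
  all inclusions $\mathcal{D}_K \to \mathcal{D}$ ($K$ compact) are continuous, where
  $\mathcal{D}_K$ has the Frechet topology of the seminorms $\sup_t |\varphi^{(n)}(t)|$.
  A base of its neighbourhoods of $0$ are the absolutely convex sets whose intersection with
  each $\mathcal{D}_K$ is a neighbourhood of $0$ in $\mathcal{D}_K$.\<close>

definition absolutely_convex :: "(real \<Rightarrow> complex) set \<Rightarrow> bool" where
  "absolutely_convex U \<longleftrightarrow>
    (\<forall>\<phi>\<in>U. \<forall>\<psi>\<in>U. \<forall>a b. cmod a + cmod b \<le> 1 \<longrightarrow> (\<lambda>t. a * \<phi> t + b * \<psi> t) \<in> U)"

definition nhd_in_D_on :: "real set \<Rightarrow> (real \<Rightarrow> complex) set \<Rightarrow> bool" where
  "nhd_in_D_on K U \<longleftrightarrow> (\<exists>N. \<exists>\<epsilon>>0. \<forall>\<phi>\<in>\<D>. supp \<phi> \<subseteq> K \<longrightarrow>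
      (\<forall>n\<le>N. \<forall>t. cmod ((derivative ^^ n) \<phi> t) \<le> \<epsilon>) \<longrightarrow> \<phi> \<in> U)"

definition basic_zero_nhd :: "(real \<Rightarrow> complex) set \<Rightarrow> bool" where
  "basic_zero_nhd U \<longleftrightarrow> U \<subseteq> \<D> \<and> absolutely_convex U \<and> (\<forall>K. compact K \<longrightarrow> nhd_in_D_on K U)"

definition test_topology :: "(real \<Rightarrow> complex) topology" where
  "test_topology = topology (\<lambda>W. W \<subseteq> \<D> \<and>
    (\<forall>\<phi>\<in>W. \<exists>U. basic_zero_nhd U \<and> (\<forall>\<psi>\<in>U. (\<lambda>t. \<phi> t + \<psi> t) \<in> W)))"

lemma nhd_in_D_on_Int:
  assumes "nhd_in_D_on K U" "nhd_in_D_on K V"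
  shows "nhd_in_D_on K (U \<inter> V)"
proof -
  obtain M \<delta> where M: "\<delta> > 0" "\<forall>\<phi>\<in>\<D>. supp \<phi> \<subseteq> K \<longrightarrow>
      (\<forall>n\<le>M. \<forall>t. cmod ((derivative ^^ n) \<phi> t) \<le> \<delta>) \<longrightarrow> \<phi> \<in> U"
    using assms(1) unfolding nhd_in_D_on_def by (elim exE conjE)
  obtain N \<epsilon> where N: "\<epsilon> > 0" "\<forall>\<phi>\<in>\<D>. supp \<phi> \<subseteq> K \<longrightarrow>
      (\<forall>n\<le>N. \<forall>t. cmod ((derivative ^^ n) \<phi> t) \<le> \<epsilon>) \<longrightarrow> \<phi> \<in> V"
    using assms(2) unfolding nhd_in_D_on_def by (elim exE conjE)
  show ?thesis
    unfolding nhd_in_D_on_def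
  proof (intro exI[of _ "max M N"] exI[of _ "min \<delta> \<epsilon>"] conjI ballI impI)
    show "min \<delta> \<epsilon> > 0" using M(1) N(1) by simp
  next
    fix \<phi> assume "\<phi> \<in> \<D>" "supp \<phi> \<subseteq> K"
      "\<forall>n\<le>max M N. \<forall>t. cmod ((derivative ^^ n) \<phi> t) \<le> min \<delta> \<epsilon>"
    then show "\<phi> \<in> U \<inter> V"
      using M(2) N(2) by simp
  qed
qed

lemma basic_zero_nhd_Int:
  assumes "basic_zero_nhd U" "basic_zero_nhd V"
  shows "basic_zero_nhd (U \<inter> V)"
  using assms unfolding basic_zero_nhd_def absolutely_convex_def by (auto intro: nhd_in_D_on_Int)

lemma openin_test_topology:
  "openin test_topology W \<longleftrightarrow> W \<subseteq> \<D> \<and>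
    (\<forall>\<phi>\<in>W. \<exists>U. basic_zero_nhd U \<and> (\<forall>\<psi>\<in>U. (\<lambda>t. \<phi> t + \<psi> t) \<in> W))"
proof -
  have "istopology (\<lambda>W. W \<subseteq> \<D> \<and>
    (\<forall>\<phi>\<in>W. \<exists>U. basic_zero_nhd U \<and> (\<forall>\<psi>\<in>U. (\<lambda>t. \<phi> t + \<psi> t) \<in> W)))" (is "istopology ?P")
    unfolding istopology_def
  proof (intro conjI allI impI)
    fix S T assume S: "?P S" and T: "?P T"
    show "S \<inter> T \<subseteq> \<D>" using S by blast
    show "\<forall>\<phi>\<in>S \<inter> T. \<exists>U. basic_zero_nhd U \<and> (\<forall>\<psi>\<in>U. (\<lambda>t. \<phi> t + \<psi> t) \<in> S \<inter> T)"
    proof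
      fix \<phi> assume "\<phi> \<in> S \<inter> T"
      then obtain U V where "basic_zero_nhd U" "\<forall>\<psi>\<in>U. (\<lambda>t. \<phi> t + \<psi> t) \<in> S"
        "basic_zero_nhd V" "\<forall>\<psi>\<in>V. (\<lambda>t. \<phi> t + \<psi> t) \<in> T"
        using S T by fast
      then show "\<exists>U. basic_zero_nhd U \<and> (\<forall>\<psi>\<in>U. (\<lambda>t. \<phi> t + \<psi> t) \<in> S \<inter> T)"
        by (intro exI[of _ "U \<inter> V"]) (auto intro: basic_zero_nhd_Int)
    qed
  next
    fix \<K> assume \<K>: "\<forall>K\<in>\<K>. ?P K"
    show "\<Union>\<K> \<subseteq> \<D>" using \<K> by blast
    show "\<forall>\<phi>\<in>\<Union>\<K>. \<exists>U. basic_zero_nhd U \<and> (\<forall>\<psi>\<in>U. (\<lambda>t. \<phi> t + \<psi> t) \<in> \<Union>\<K>)"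
    proof
      fix \<phi> assume "\<phi> \<in> \<Union>\<K>"
      then obtain K where "K \<in> \<K>" "\<phi> \<in> K" by blast
      then obtain U where "basic_zero_nhd U" "\<forall>\<psi>\<in>U. (\<lambda>t. \<phi> t + \<psi> t) \<in> K"
        using \<K> by fast
      with \<open>K \<in> \<K>\<close> show "\<exists>U. basic_zero_nhd U \<and> (\<forall>\<psi>\<in>U. (\<lambda>t. \<phi> t + \<psi> t) \<in> \<Union>\<K>)"
        by (intro exI[of _ U]) auto
    qed
  qed
  then show ?thesis
    unfolding test_topology_def by (simp add: topology_inverse')
qed

lemma derivative_funpow_lincomb:
  assumes "smooth \<phi>" "smooth \<psi>"
  shows "(derivative ^^ n) (\<lambda>t. a * \<phi> t + b * \<psi> t) =
    (\<lambda>t. a * (derivative ^^ n) \<phi> t + b * (derivative ^^ n) \<psi> t)"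
proof (induction n)
  case (Suc n)
  have "((derivative ^^ n) f has_vector_derivative derivative ((derivative ^^ n) f) t) (at t)"
    if "smooth f" for f t
    using that unfolding derivative_def smooth_def by (simp add: vector_derivative_works)
  then have "((\<lambda>t. a * (derivative ^^ n) \<phi> t + b * (derivative ^^ n) \<psi> t) has_vector_derivative
      a * derivative ((derivative ^^ n) \<phi>) t + b * derivative ((derivative ^^ n) \<psi>) t) (at t)" for t
    using assms by (intro has_vector_derivative_add has_vector_derivative_mult_right)
  then have "derivative (\<lambda>t. a * (derivative ^^ n) \<phi> t + b * (derivative ^^ n) \<psi> t) =
      (\<lambda>t. a * derivative ((derivative ^^ n) \<phi>) t + b * derivative ((derivative ^^ n) \<psi>) t)"
    unfolding derivative_def by (intro ext vector_derivative_at)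
  then show ?case
    by (simp add: Suc.IH)
qed simp

lemma test_functions_lincomb:
  assumes "\<phi> \<in> \<D>" "\<psi> \<in> \<D>"
  shows "(\<lambda>t. a * \<phi> t + b * \<psi> t) \<in> \<D>"
proof -
  have "supp (\<lambda>t. a * \<phi> t + b * \<psi> t) \<subseteq> supp \<phi> \<union> supp \<psi>"
    unfolding supp_def closure_Un[symmetric] by (intro closure_mono) auto
  moreover have "compact (supp \<phi> \<union> supp \<psi>)"
    using assms by (auto simp: test_functions_def)
  ultimately have "compact (supp (\<lambda>t. a * \<phi> t + b * \<psi> t))"
    by (metis bounded_subset closed_closure compact_eq_bounded_closed supp_def)
  then show ?thesis
    using assms by (simp add: test_functions_def smooth_def derivative_funpow_lincomb)
qed

lemma topspace_test_topology: "topspace test_topology = \<D>"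
proof -
  have "basic_zero_nhd \<D>"
    using test_functions_lincomb
    by (auto simp: basic_zero_nhd_def absolutely_convex_def nhd_in_D_on_def intro: exI[of _ 1])
  moreover have "(\<lambda>t. \<phi> t + \<psi> t) \<in> \<D>" if "\<phi> \<in> \<D>" "\<psi> \<in> \<D>" for \<phi> \<psi>
    using test_functions_lincomb[OF that, of 1 1] by simp
  ultimately have "openin test_topology \<D>"
    unfolding openin_test_topology by blast
  then show ?thesis
    using openin_subset[of test_topology \<D>] openin_topspace[of test_topology]
    unfolding openin_test_topology[of "topspace test_topology"] by blast
qed


section \<open>Distributions\<close>

definition dist_support :: "((real \<Rightarrow> complex) \<Rightarrow> 'b::zero) \<Rightarrow> real set" where
  "dist_support G = - \<Union>{\<Omega>. open \<Omega> \<and> (\<forall>\<phi>\<in>\<D>. supp \<phi> \<subseteq> \<Omega> \<longrightarrow> G \<phi> = 0)}"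

text \<open>The space $\mathcal{D}'_0(L(E))$. Distributions are functions on all of
  \<^typ>\<open>real \<Rightarrow> complex\<close> of which only the values on $\mathcal{D}$ matter.\<close>

definition op_distributions_0 :: "((real \<Rightarrow> complex) \<Rightarrow> ('a::cbanach \<Rightarrow>\<^sub>L 'a)) set" where
  "op_distributions_0 = {G.
    (\<forall>\<phi>\<in>\<D>. G \<phi> \<in> clinear_ops) \<and>
    (\<forall>\<phi>\<in>\<D>. \<forall>\<psi>\<in>\<D>. G (\<lambda>t. \<phi> t + \<psi> t) = G \<phi> + G \<psi>) \<and>
    (\<forall>\<phi>\<in>\<D>. \<forall>a x. blinfun_apply (G (\<lambda>t. a * \<phi> t)) x = a *\<^sub>C blinfun_apply (G \<phi>) x) \<and>
    continuous_map test_topology euclidean G \<and>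
    dist_support G \<subseteq> {0..}}"

text \<open>$\int_0^t$ is oriented, hence the sign for negative $t$.\<close>

definition conv0 :: "(real \<Rightarrow> complex) \<Rightarrow> (real \<Rightarrow> complex) \<Rightarrow> real \<Rightarrow> complex"
    (infixl \<open>*\<^sub>0\<close> 70) where
  "(\<phi> *\<^sub>0 \<psi>) t = (if 0 \<le> t then integral {0..t} (\<lambda>s. \<phi> (t - s) * \<psi> s)
                  else - integral {t..0} (\<lambda>s. \<phi> (t - s) * \<psi> s))"

definition dist_conv :: "((real \<Rightarrow> complex) \<Rightarrow> complex) \<Rightarrow> (real \<Rightarrow> complex) \<Rightarrow> real \<Rightarrow> complex" where
  "dist_conv T \<phi> = (\<lambda>t. T (\<lambda>s. \<phi> (t - s)))"

definition dist_deriv :: "((real \<Rightarrow> complex) \<Rightarrow> complex) \<Rightarrow> (real \<Rightarrow> complex) \<Rightarrow> complex" where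
  "dist_deriv T \<phi> = - T (derivative \<phi>)"

definition dirac :: "real \<Rightarrow> (real \<Rightarrow> complex) \<Rightarrow> complex" where
  "dirac t \<phi> = \<phi> t"

lemma dist_conv_dirac: "dist_conv (dirac t) \<phi> = (\<lambda>s. \<phi> (s - t))"
  by (simp add: dist_conv_def dirac_def)

lemma dist_conv_minus_dirac_deriv:
  assumes "\<phi> \<in> \<D>"
  shows "dist_conv (\<lambda>\<psi>. - dist_deriv (dirac 0) \<psi>) \<phi> = (\<lambda>t. - derivative \<phi> t)"
proof
  fix t
  have "(\<phi> has_vector_derivative derivative \<phi> t) (at (t - 0))"
    using assms unfolding test_functions_def smooth_def derivative_def
    by (metis (mono_tags, lifting) diff_zero funpow_0 mem_Collect_eq vector_derivative_works)
  then have "((\<phi> \<circ> (\<lambda>s. t - s)) has_vector_derivative (-1) *\<^sub>R derivative \<phi> t) (at 0)"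
    by (intro vector_diff_chain_at) (auto intro!: derivative_eq_intros)
  then show "dist_conv (\<lambda>\<psi>. - dist_deriv (dirac 0) \<psi>) \<phi> t = - derivative \<phi> t"
    by (simp add: dist_conv_def dist_deriv_def dirac_def o_def derivative_def[of "\<lambda>s. \<phi> (t - s)"]
        vector_derivative_at)
qed


section \<open>$C$-distribution semigroups\<close>

definition C_distribution_semigroup ::
    "('a::cbanach \<Rightarrow>\<^sub>L 'a) \<Rightarrow> ((real \<Rightarrow> complex) \<Rightarrow> ('a \<Rightarrow>\<^sub>L 'a)) \<Rightarrow> bool" where
  "C_distribution_semigroup C G \<longleftrightarrow>
    G \<in> op_distributions_0 \<and>
    (\<forall>\<phi>\<in>\<D>. C o\<^sub>L G \<phi> = G \<phi> o\<^sub>L C) \<and>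
    (\<forall>\<phi>\<in>\<D>. \<forall>\<psi>\<in>\<D>. G (\<phi> *\<^sub>0 \<psi>) o\<^sub>L C = G \<phi> o\<^sub>L G \<psi>) \<and>
    (\<Inter>\<phi>\<in>\<D>\<^sub>0. {x. blinfun_apply (G \<phi>) x = 0}) = {0}"

text \<open>Unbounded operators are identified with their graphs; \<open>op_app\<close> is evaluation and is
  meaningful only on the domain of a single-valued relation.\<close>

definition op_app :: "('a \<times> 'a) set \<Rightarrow> 'a \<Rightarrow> 'a" where
  "op_app R x = (THE y. (x, y) \<in> R)"

text \<open>The operator $G(T)$ for a scalar distribution $T$ with compact support in $[0,\infty)$.\<close>

definition dist_op ::
    "((real \<Rightarrow> complex) \<Rightarrow> ('a::cbanach \<Rightarrow>\<^sub>L 'a)) \<Rightarrow> ((real \<Rightarrow> complex) \<Rightarrow> complex) \<Rightarrow> ('a \<times> 'a) set" where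
  "dist_op G T = {(x, y). \<forall>\<phi>\<in>\<D>\<^sub>0. blinfun_apply (G (dist_conv T \<phi>)) x = blinfun_apply (G \<phi>) y}"

definition generator :: "((real \<Rightarrow> complex) \<Rightarrow> ('a::cbanach \<Rightarrow>\<^sub>L 'a)) \<Rightarrow> ('a \<times> 'a) set" where
  "generator G = dist_op G (\<lambda>\<phi>. - dist_deriv (dirac 0) \<phi>)"

definition solution_space :: "('a::banach \<times> 'a) set \<Rightarrow> 'a set" where
  "solution_space A = {x. \<exists>u::real \<Rightarrow> 'a. continuous_on {0..} u \<and>
    (\<forall>t\<ge>0. (integral {0..t} u, u t - x) \<in> A)}"


section \<open>Almost periodicity\<close>

definition almost_periodic_on :: "real set \<Rightarrow> (real \<Rightarrow> 'a::real_normed_vector) \<Rightarrow> bool" where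
  "almost_periodic_on I f \<longleftrightarrow> continuous_on I f \<and>
    (\<forall>\<epsilon>>0. \<exists>l>0. \<forall>a. {a..a + l} \<subseteq> I \<longrightarrow>
      (\<exists>\<tau>\<in>{a..a + l}. \<forall>t\<in>I. norm (f (t + \<tau>) - f t) \<le> \<epsilon>))"

text \<open>The extension operator $F$ from $AP([0,\infty):E)$ to $AP(\mathbb{R}:E)$.\<close>

definition ap_extension :: "(real \<Rightarrow> 'a::banach) \<Rightarrow> real \<Rightarrow> 'a" where
  "ap_extension f = (THE g. almost_periodic_on UNIV g \<and> (\<forall>t\<ge>0. g t = f t))"

definition semigroup_almost_periodic ::
    "((real \<Rightarrow> complex) \<Rightarrow> ('a::cbanach \<Rightarrow>\<^sub>L 'a)) \<Rightarrow> 'a set \<Rightarrow> bool" where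
  "semigroup_almost_periodic G V \<longleftrightarrow>
    (\<forall>x\<in>V. almost_periodic_on {0..} (\<lambda>t. op_app (dist_op G (dirac t)) x))"

end

theory Submission
  imports Defs
begin

text \<open>If \<open>u\<close> is a mild solution starting at \<open>x\<close> and \<open>U\<close> its primitive, then differentiating
  \<open>G(\<phi>(\<cdot> - (t - s))) (U s)\<close> in \<open>s\<close> gives \<open>G(\<phi>) (U t) = \<integral>\<^sub>0\<^sup>t G(\<phi>(\<cdot> - r)) x dr\<close>, so that
  \<open>u t = G(\<delta>\<^sub>t) x\<close>. Mild solutions are thus unique, and claims about \<open>G(\<delta>\<^sub>t)\<close> reduce to
  translating them. An almost periodic \<open>f\<close> extending \<open>u\<close> to the line is a uniform limit of its
  translates by almost periods tending to infinity. Since the generator is closed, every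
  \<open>f(\<cdot> + s)\<close> is therefore again a mild solution, and the remaining identities follow from the
  uniqueness of almost periodic extensions.\<close>

section \<open>Almost periodic extensions\<close>

lemma almost_periodic_onD:
  assumes "almost_periodic_on I f" "\<epsilon> > 0" "{a..} \<subseteq> I"
  obtains \<tau> where "\<tau> \<ge> a" "\<And>t. t \<in> I \<Longrightarrow> norm (f (t + \<tau>) - f t) \<le> \<epsilon>"
proof -
  obtain l where "\<forall>a. {a..a + l} \<subseteq> I \<longrightarrow> (\<exists>\<tau>\<in>{a..a + l}. \<forall>t\<in>I. norm (f (t + \<tau>) - f t) \<le> \<epsilon>)"
    using assms(1,2) unfolding almost_periodic_on_def by blast
  moreover have "{a..a + l} \<subseteq> I"
    using assms(3) by auto
  ultimately show ?thesis
    using that by fastforce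
qed

text \<open>The bound \<open>\<tau> n \<ge> real n\<close> moves every point of the line into
  \<open>{0..}\<close> for large \<open>n\<close>, while the tolerance 1/(n+1) makes the translates
  by \<open>\<tau> n\<close> converge to \<open>f\<close> uniformly on \<open>I\<close>.\<close>

lemma almost_periods_sequence:
  assumes "almost_periodic_on I f" "{0..} \<subseteq> I"
  obtains \<tau> :: "nat \<Rightarrow> real" where "\<And>n. \<tau> n \<ge> real n"
    "\<And>n t. t \<in> I \<Longrightarrow> norm (f (t + \<tau> n) - f t) \<le> inverse (real (Suc n))"
proof -
  have "\<exists>\<tau>. \<tau> \<ge> real n \<and> (\<forall>t\<in>I. norm (f (t + \<tau>) - f t) \<le> inverse (real (Suc n)))" for n
  proof -
    have "{real n..} \<subseteq> I" using assms(2) by force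
    then show ?thesis
      by (metis almost_periodic_onD[OF assms(1)] positive_imp_inverse_positive of_nat_0_less_iff zero_less_Suc)
  qed
  then show ?thesis using that by metis
qed

lemma tendsto_of_almost_periods:
  assumes "\<And>n t. t \<in> I \<Longrightarrow> norm (f (t + \<tau> n) - f t) \<le> inverse (real (Suc n))" "t \<in> I"
  shows "(\<lambda>n. f (t + \<tau> n)) \<longlonglongrightarrow> f t"
proof -
  have "(\<lambda>n. f (t + \<tau> n) - f t) \<longlonglongrightarrow> 0"
    using assms by (intro Lim_null_comparison[OF _ LIMSEQ_inverse_real_of_nat]) auto
  then show ?thesis by (simp add: LIM_zero_iff)
qed

lemma almost_periodic_on_shift:
  assumes "almost_periodic_on UNIV f"
  shows "almost_periodic_on UNIV (\<lambda>t. f (t + s))"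
proof -
  have "continuous_on UNIV (\<lambda>t. f (t + s))"
    using assms unfolding almost_periodic_on_def
    by (auto intro!: continuous_intros intro: continuous_on_compose2)
  moreover have "norm (f (t + \<tau> + s) - f (t + s)) \<le> \<epsilon>"
    if "\<And>t. norm (f (t + \<tau>) - f t) \<le> \<epsilon>" for t \<tau> \<epsilon>
    using that[of "t + s"] by (simp add: algebra_simps)
  ultimately show ?thesis
    using assms unfolding almost_periodic_on_def by (metis UNIV_I)
qed

text \<open>Almost periods taken from intervals inside the half-line are nonnegative, so every value
  entering the definition is taken at a nonnegative time. The lemma serves to pass from
  \<open>op_app (dist_op G (dirac t))\<close> to \<open>T t\<close>, which agree only for t \<ge>
  0.\<close>

lemma almost_periodic_on_nonneg_cong:
  assumes f: "almost_periodic_on {0..} f" and eq: "\<And>t. t \<ge> 0 \<Longrightarrow> f t = g t"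
  shows "almost_periodic_on {0..} g"
  unfolding almost_periodic_on_def
proof (intro conjI allI impI)
  show "continuous_on {0..} g"
    using f eq continuous_on_cong[of "{0..}" "{0..}" f g] by (auto simp: almost_periodic_on_def)
  fix \<epsilon> :: real assume "\<epsilon> > 0"
  then obtain l where l: "l > 0" "\<And>a. {a..a + l} \<subseteq> {0..} \<Longrightarrow>
      \<exists>\<tau>\<in>{a..a + l}. \<forall>t\<in>{0..}. norm (f (t + \<tau>) - f t) \<le> \<epsilon>"
    using f unfolding almost_periodic_on_def by blast
  have "\<exists>\<tau>\<in>{a..a + l}. \<forall>t\<in>{0..}. norm (g (t + \<tau>) - g t) \<le> \<epsilon>" if a: "{a..a + l} \<subseteq> {0..}" for a
  proof -
    obtain \<tau> where \<tau>: "\<tau> \<in> {a..a + l}" "\<forall>t\<in>{0..}. norm (f (t + \<tau>) - f t) \<le> \<epsilon>"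
      using l(2)[OF a] by blast
    from \<tau>(1) a have "\<tau> \<ge> 0" by auto
    with \<tau> eq show ?thesis by (intro bexI[of _ \<tau>]) auto
  qed
  with l(1) show "\<exists>l>0. \<forall>a. {a..a + l} \<subseteq> {0..} \<longrightarrow>
      (\<exists>\<tau>\<in>{a..a + l}. \<forall>t\<in>{0..}. norm (g (t + \<tau>) - g t) \<le> \<epsilon>)" by blast
qed

text \<open>The extension is the pointwise limit of the translates \<open>f (t + \<tau> n)\<close>.
  For a given t only indices n \<ge> -t matter, since for these the argument lies in the half-line
  where \<open>f\<close> is controlled.\<close>

lemma almost_periodic_extension_exists:
  fixes f :: "real \<Rightarrow> 'a::banach"
  assumes f: "almost_periodic_on {0..} f"
  shows "\<exists>g. almost_periodic_on UNIV g \<and> (\<forall>t\<ge>0. g t = f t)"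
proof -
  obtain \<tau> :: "nat \<Rightarrow> real" where \<tau>: "\<And>n. \<tau> n \<ge> real n"
    "\<And>n t. t \<in> {0..} \<Longrightarrow> norm (f (t + \<tau> n) - f t) \<le> inverse (real (Suc n))"
    using almost_periods_sequence[OF f order_refl] by metis
  \<comment> \<open>Compare both values with \<open>f (t + \<tau> n + \<tau> m)\<close>.\<close>
  have close: "norm (f (t + \<tau> n) - f (t + \<tau> m)) \<le> inverse (real (Suc n)) + inverse (real (Suc m))"
    if "n \<ge> N" "m \<ge> N" "t \<ge> - real N" for N n m t
  proof -
    have nn: "real n \<ge> real N" "real m \<ge> real N" using that by simp_all
    then have "t + \<tau> n \<ge> 0" "t + \<tau> m \<ge> 0"
      using that(3) \<tau>(1)[of n] \<tau>(1)[of m] by linarith+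
    then have "dist (f (t + \<tau> n + \<tau> m)) (f (t + \<tau> n)) \<le> inverse (real (Suc m))"
      "dist (f (t + \<tau> n + \<tau> m)) (f (t + \<tau> m)) \<le> inverse (real (Suc n))"
      using \<tau>(2)[of "t + \<tau> n" m] \<tau>(2)[of "t + \<tau> m" n] by (simp_all add: dist_norm ac_simps)
    then show ?thesis
      unfolding dist_norm[symmetric] by metric
  qed
  have bound: "\<exists>N. t \<ge> - real N" for t
    by (metis minus_le_iff real_arch_simple)
  have "\<exists>L. (\<lambda>n. f (t + \<tau> n)) \<longlonglongrightarrow> L" for t
  proof -
    obtain N where N: "t \<ge> - real N" using bound by blast
    have "Cauchy (\<lambda>n. f (t + \<tau> n))"
    proof (rule metric_CauchyI)
      fix e :: real assume "e > 0"
      then obtain M where M: "inverse (real (Suc M)) < e / 2"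
        using reals_Archimedean[of "e/2"] by auto
      have "dist (f (t + \<tau> m)) (f (t + \<tau> n)) < e" if "m \<ge> max M N" "n \<ge> max M N" for m n
      proof -
        have "inverse (real (Suc m)) \<le> inverse (real (Suc M))" "inverse (real (Suc n)) \<le> inverse (real (Suc M))"
          using that by (auto intro!: le_imp_inverse_le)
        moreover have "dist (f (t + \<tau> m)) (f (t + \<tau> n)) \<le> inverse (real (Suc m)) + inverse (real (Suc n))"
          unfolding dist_norm using close[of N m n t] that N by simp
        ultimately show ?thesis
          using M by linarith
      qed
      then show "\<exists>M. \<forall>m\<ge>M. \<forall>n\<ge>M. dist (f (t + \<tau> m)) (f (t + \<tau> n)) < e" by blast
    qed
    then show ?thesis by (metis Cauchy_convergent convergent_def)
  qed
  then obtain g where g: "\<And>t. (\<lambda>n. f (t + \<tau> n)) \<longlonglongrightarrow> g t" by metis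
  \<comment> \<open>Letting m tend to infinity in \<open>close\<close> gives a rate that depends on
    n alone, hence uniform convergence on each half-line to the right of -N.\<close>
  have unif: "norm (f (t + \<tau> n) - g t) \<le> inverse (real (Suc n))" if "n \<ge> N" "t \<ge> - real N" for N n t
  proof (rule LIMSEQ_le[OF tendsto_norm])
    show "(\<lambda>m. f (t + \<tau> n) - f (t + \<tau> m)) \<longlonglongrightarrow> f (t + \<tau> n) - g t"
      by (intro tendsto_intros g)
    show "(\<lambda>m. inverse (real (Suc n)) + inverse (real (Suc m))) \<longlonglongrightarrow> inverse (real (Suc n))"
      using tendsto_add[OF tendsto_const LIMSEQ_inverse_real_of_nat] by simp
    show "\<exists>M. \<forall>m\<ge>M. norm (f (t + \<tau> n) - f (t + \<tau> m)) \<le> inverse (real (Suc n)) + inverse (real (Suc m))"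
      using close that by blast
  qed
  \<comment> \<open>The translates are continuous only where their argument is nonnegative, so
    continuity is obtained on half-lines first. These are taken open so that continuity glues over
    their union.\<close>
  have "continuous_on {- real N<..} g" for N
  proof (rule uniform_limit_theorem[OF _ _ trivial_limit_sequentially])
    show "\<forall>\<^sub>F n in sequentially. continuous_on {- real N<..} (\<lambda>t. f (t + \<tau> n))"
      using eventually_ge_at_top[of N]
    proof eventually_elim
      case (elim n)
      have "t + \<tau> n \<ge> 0" if "t > - real N" for t
        using that elim \<tau>(1)[of n] by (smt (verit) of_nat_mono)
      then show ?case
        using f unfolding almost_periodic_on_def
        by (auto intro!: continuous_intros intro: continuous_on_compose2[of "{0..}" f])
    qed
    show "uniform_limit {- real N<..} (\<lambda>n t. f (t + \<tau> n)) g sequentially"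
    proof (rule uniform_limitI)
      fix e :: real assume "e > 0"
      then have "\<forall>\<^sub>F n in sequentially. inverse (real (Suc n)) < e"
        using LIMSEQ_inverse_real_of_nat order_tendstoD(2) by blast
      then show "\<forall>\<^sub>F n in sequentially. \<forall>t\<in>{- real N<..}. dist (f (t + \<tau> n)) (g t) < e"
        using eventually_ge_at_top[of N]
      proof eventually_elim
        case (elim n)
        show ?case
          unfolding dist_norm using elim le_less_trans[OF unif[OF elim(2)] elim(1)] by simp
      qed
    qed
  qed
  then have "continuous_on (\<Union>N. {- real N<..}) g"
    by (intro continuous_on_open_UN) auto
  moreover have "(\<Union>N. {- real N<..}) = UNIV"
    by (metis (mono_tags, lifting) UNIV_eq_I UN_iff UNIV_I greaterThan_iff minus_less_iff reals_Archimedean2)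
  ultimately have cont: "continuous_on UNIV g" by simp
  \<comment> \<open>A nonnegative almost period of \<open>f\<close> on the half-line is one of
    \<open>g\<close> on the whole line: the inequality holds at \<open>t + \<tau> n\<close> for
    large \<open>n\<close> and passes to the limit.\<close>
  have period: "norm (g (t + p) - g t) \<le> \<epsilon>" if "p \<ge> 0" "\<And>t. t \<ge> 0 \<Longrightarrow> norm (f (t + p) - f t) \<le> \<epsilon>" for p t \<epsilon>
  proof (rule LIMSEQ_le_const2[OF tendsto_norm])
    show "(\<lambda>n. f (t + p + \<tau> n) - f (t + \<tau> n)) \<longlonglongrightarrow> g (t + p) - g t"
      by (intro tendsto_intros g)
    obtain N where N: "t \<ge> - real N" using bound by blast
    have "norm (f (t + p + \<tau> n) - f (t + \<tau> n)) \<le> \<epsilon>" if "n \<ge> N" for n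
    proof -
      have "t + \<tau> n \<ge> 0"
        using N that \<tau>(1)[of n] by (smt (verit) of_nat_mono)
      then show ?thesis
        using \<open>\<And>t. t \<ge> 0 \<Longrightarrow> _\<close>[of "t + \<tau> n"] by (simp add: algebra_simps)
    qed
    then show "\<exists>N. \<forall>n\<ge>N. norm (f (t + p + \<tau> n) - f (t + \<tau> n)) \<le> \<epsilon>" by blast
  qed
  have "\<exists>l>0. \<forall>a. \<exists>p\<in>{a..a + l}. \<forall>t. norm (g (t + p) - g t) \<le> \<epsilon>" if \<epsilon>: "\<epsilon> > 0" for \<epsilon>
  proof -
    obtain l where l: "l > 0" "\<And>a. {a..a + l} \<subseteq> {0..} \<Longrightarrow>
        \<exists>p\<in>{a..a + l}. \<forall>t\<in>{0..}. norm (f (t + p) - f t) \<le> \<epsilon>"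
      using f \<epsilon> unfolding almost_periodic_on_def by blast
    have l': "\<exists>p\<in>{a..a + l}. \<forall>t\<ge>0. norm (f (t + p) - f t) \<le> \<epsilon>" if "a \<ge> 0" for a
      using l(2)[of a] that by fastforce
    \<comment> \<open>If a < 0 < a + l, neither [a, a + l] nor its reflection lies in the half-line,
      hence the doubled length. Either the right half [a + l, a + 2l] lies in the half-line, or the
      reflection of [a, a + l] does; in the latter case the negative of an almost period on the line
      is again one.\<close>
    have "\<exists>p\<in>{a..a + 2 * l}. \<forall>t. norm (g (t + p) - g t) \<le> \<epsilon>" for a
    proof (cases "a + l \<ge> 0")
      case True
      from l'[OF True] obtain p where "p \<in> {a + l..a + l + l}" "\<forall>t\<ge>0. norm (f (t + p) - f t) \<le> \<epsilon>" by blast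
      with True l(1) show ?thesis
        by (intro bexI[of _ p] allI period) auto
    next
      case False
      then have "- (a + l) \<ge> 0" by simp
      from l'[OF this] obtain p where p: "p \<in> {- (a + l)..- (a + l) + l}"
        "\<forall>t\<ge>0. norm (f (t + p) - f t) \<le> \<epsilon>" by blast
      have "norm (g (t + - p) - g t) \<le> \<epsilon>" for t
        using period[of p \<epsilon> "t - p"] p False by (simp add: norm_minus_commute)
      with p l(1) show ?thesis
        by (intro bexI[of _ "- p"] allI) auto
    qed
    with l(1) show ?thesis
      by (intro exI[of _ "2 * l"]) simp
  qed
  with cont have "almost_periodic_on UNIV g"
    by (simp add: almost_periodic_on_def)
  moreover have "g t = f t" if "t \<ge> 0" for t
    using LIMSEQ_unique[OF g tendsto_of_almost_periods[of "{0..}" f \<tau> t]] \<tau>(2) that by simp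
  ultimately show ?thesis by blast
qed

text \<open>Large almost periods carry any point into the half-line, where the two functions
  coincide.\<close>

lemma almost_periodic_extension_unique:
  fixes g h :: "real \<Rightarrow> 'a::real_normed_vector"
  assumes g: "almost_periodic_on UNIV g" and h: "almost_periodic_on UNIV h"
    and eq: "\<And>t. t \<ge> 0 \<Longrightarrow> g t = h t"
  shows "g = h"
proof
  fix t
  have "norm (g t - h t) \<le> e" if "e > 0" for e
  proof -
    \<comment> \<open>The chain from \<open>g t\<close> to \<open>h t\<close> runs through
      \<open>h (t + p)\<close>, \<open>h (t + p + q)\<close> and \<open>h (t + q)\<close>: four
      links, each one almost period long.\<close>
    from that have "e / 4 > 0" by simp
    obtain p where p: "p \<ge> max 0 (- t)" "\<And>t. norm (g (t + p) - g t) \<le> e / 4"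
      using almost_periodic_onD[OF g \<open>e / 4 > 0\<close>] by (metis UNIV_I subset_UNIV)
    obtain q where q: "q \<ge> max 0 (- t)" "\<And>t. norm (h (t + q) - h t) \<le> e / 4"
      using almost_periodic_onD[OF h \<open>e / 4 > 0\<close>] by (metis UNIV_I subset_UNIV)
    \<comment> \<open>A common almost period is not needed: both values are close to the one at \<open>t + p + q\<close>.\<close>
    have "g (t + p) = h (t + p)" "g (t + q) = h (t + q)" "g (t + q + p) = h (t + p + q)"
      using p(1) q(1) eq[of "t + p"] eq[of "t + q"] eq[of "t + p + q"] by (simp_all add: add_ac)
    then have "dist (g t) (h (t + p)) \<le> e / 4" "dist (h (t + p)) (h (t + p + q)) \<le> e / 4"
      "dist (h (t + p + q)) (h (t + q)) \<le> e / 4" "dist (h (t + q)) (h t) \<le> e / 4"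
      using p(2)[of t] q(2)[of "t + p"] p(2)[of "t + q"] q(2)[of t] by (simp_all add: dist_norm norm_minus_commute)
    then have "dist (g t) (h t) \<le> e" by metric
    then show ?thesis by (simp add: dist_norm)
  qed
  then have "norm (g t - h t) \<le> 0" by (rule field_le_epsilon[of _ 0, simplified])
  then show "g t = h t" by simp
qed

text \<open>Since \<open>ap_extension\<close> is a definite description, an identity between
  extensions is proved by exhibiting one almost periodic candidate with the right values on the
  half-line.\<close>

lemma ap_extension_eqI:
  assumes "almost_periodic_on UNIV g" "\<And>t. t \<ge> 0 \<Longrightarrow> g t = f t"
  shows "ap_extension f = g"
  unfolding ap_extension_def
  using assms by (intro the_equality) (auto intro: almost_periodic_extension_unique)

lemma ap_extension:
  assumes "almost_periodic_on {0..} f"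
  shows almost_periodic_ap_extension: "almost_periodic_on UNIV (ap_extension f)"
    and ap_extension_nonneg: "t \<ge> 0 \<Longrightarrow> ap_extension f t = f t"
  using almost_periodic_extension_exists[OF assms] ap_extension_eqI by metis+

section \<open>Translation of test functions\<close>

lemma derivative_works:
  "\<phi> differentiable at t \<Longrightarrow> (\<phi> has_vector_derivative derivative \<phi> t) (at t)"
  by (simp add: derivative_def vector_derivative_works)

lemma has_vector_derivative_translate:
  assumes "(\<phi> has_vector_derivative d) (at (t - r))"
  shows "((\<lambda>t. \<phi> (t - r)) has_vector_derivative d) (at (t::real))"
  using vector_diff_chain_at[of "\<lambda>t. t - r" 1 t \<phi> d] assms
  by (simp add: o_def has_vector_derivative_diff_const)

lemma derivative_shift:
  assumes "\<And>t. \<phi> differentiable at t"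
  shows "derivative (\<lambda>t. \<phi> (t - r)) = (\<lambda>t. derivative \<phi> (t - r))"
  unfolding derivative_def[of "\<lambda>t. \<phi> (t - r)"]
  by (intro ext vector_derivative_at has_vector_derivative_translate derivative_works assms)

lemma derivative_funpow_shift:
  assumes "smooth \<phi>"
  shows "(derivative ^^ n) (\<lambda>t. \<phi> (t - r)) = (\<lambda>t. (derivative ^^ n) \<phi> (t - r))"
proof (induction n)
  case (Suc n)
  then show ?case
    using assms derivative_shift[of "(derivative ^^ n) \<phi>" r] by (simp add: smooth_def)
qed simp

lemma eq_0_outside_supp: "t \<notin> supp \<phi> \<Longrightarrow> \<phi> t = 0"
  unfolding supp_def by (metis (mono_tags, lifting) closure_subset mem_Collect_eq subsetD)

text \<open>The complement of the closed support is open, so the function vanishes in a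
  neighbourhood of the point.\<close>

lemma derivative_eq_0_outside_supp:
  assumes "t \<notin> supp \<phi>"
  shows "derivative \<phi> t = 0"
proof -
  have "open (- supp \<phi>)" by (simp add: supp_def open_Compl)
  moreover have "\<phi> s = 0" if "s \<in> - supp \<phi>" for s
    using that eq_0_outside_supp by simp
  ultimately have "(\<phi> has_vector_derivative 0) (at t)"
    using assms by (intro has_vector_derivative_transform_within_open[of "\<lambda>_. 0" 0 t "- supp \<phi>" \<phi>]) auto
  then show ?thesis by (simp add: derivative_def vector_derivative_at)
qed

lemma supp_derivative: "supp (derivative \<phi>) \<subseteq> supp \<phi>"
  unfolding supp_def[of "derivative \<phi>"]
  by (rule closure_minimal) (use derivative_eq_0_outside_supp in \<open>auto simp: supp_def\<close>)

lemma supp_shift: "supp (\<lambda>t. \<phi> (t - r)) = (+) r ` supp \<phi>"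
proof -
  have "{t. \<phi> (t - r) \<noteq> 0} = (+) r ` {t. \<phi> t \<noteq> 0}"
    by (auto simp: image_iff) (metis add_diff_cancel_left' diff_add_cancel add.commute)
  then show ?thesis by (simp add: supp_def closure_translation)
qed

lemma test_functions_shift:
  assumes "\<phi> \<in> \<D>"
  shows "(\<lambda>t. \<phi> (t - r)) \<in> \<D>"
proof -
  have "(\<lambda>t. (derivative ^^ n) \<phi> (t - r)) differentiable at t" for n t
    using assms unfolding test_functions_def smooth_def
    by (blast intro: differentiableI_vector has_vector_derivative_translate derivative_works)
  then show ?thesis
    using assms
    by (simp add: test_functions_def smooth_def derivative_funpow_shift supp_shift compact_translation)
qed

lemma test_functions_derivative: "\<phi> \<in> \<D> \<Longrightarrow> derivative \<phi> \<in> \<D>"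
proof -
  assume \<phi>: "\<phi> \<in> \<D>"
  have "smooth (derivative \<phi>)"
    using \<phi> unfolding test_functions_def smooth_def by (metis (mono_tags, lifting) funpow_Suc_right mem_Collect_eq o_apply)
  moreover have "compact (supp (derivative \<phi>))"
    using \<phi> supp_derivative[of \<phi>] unfolding test_functions_def
    by (metis (mono_tags, lifting) bounded_subset closed_closure compact_eq_bounded_closed mem_Collect_eq supp_def)
  ultimately show ?thesis by (simp add: test_functions_def)
qed

lemma test_functions_derivative_funpow: "\<phi> \<in> \<D> \<Longrightarrow> (derivative ^^ n) \<phi> \<in> \<D>"
  by (induction n) (auto intro: test_functions_derivative)

lemma test_functions_0_subset: "\<phi> \<in> \<D>\<^sub>0 \<Longrightarrow> \<phi> \<in> \<D>"
  by (simp add: test_functions_0_def)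

lemma test_functions_0_shift: "\<phi> \<in> \<D>\<^sub>0 \<Longrightarrow> r \<ge> 0 \<Longrightarrow> (\<lambda>t. \<phi> (t - r)) \<in> \<D>\<^sub>0"
  unfolding test_functions_0_def using test_functions_shift by (auto simp: supp_shift)

lemma test_functions_differentiable: "\<phi> \<in> \<D> \<Longrightarrow> \<phi> differentiable at t"
  by (auto simp: test_functions_def smooth_def dest: spec[of _ 0])

section \<open>Estimates for test functions and differentiation of translates under a
  distribution\<close>

lemma test_functions_bounded:
  assumes "\<phi> \<in> \<D>"
  obtains M where "\<And>t. norm (\<phi> t) \<le> M"
proof -
  have "continuous_on (supp \<phi>) \<phi>"
    using test_functions_differentiable[OF assms]
    by (simp add: continuous_at_imp_continuous_on differentiable_imp_continuous_within)
  then have "bounded (\<phi> ` supp \<phi>)"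
    using assms by (auto simp: test_functions_def intro: compact_imp_bounded compact_continuous_image)
  then obtain M where M: "\<And>t. t \<in> supp \<phi> \<Longrightarrow> norm (\<phi> t) \<le> M"
    by (auto simp: bounded_iff)
  \<comment> \<open>If the support is empty, \<open>M\<close> is unconstrained and may be negative;
    the maximum also covers the value 0 outside the support.\<close>
  have "norm (\<phi> t) \<le> max M 0" for t
  proof (cases "t \<in> supp \<phi>")
    case False
    then show ?thesis by (simp add: eq_0_outside_supp)
  qed (use M in fastforce)
  then show ?thesis using that by blast
qed

text \<open>Continuity at the zero function for the inductive limit topology, brought into usable
  form: on test functions supported in \<open>K\<close>, smallness of finitely many derivatives
  forces smallness of \<open>G\<close> in operator norm.\<close>

lemma op_distribution_bounded_on:
  fixes G :: "(real \<Rightarrow> complex) \<Rightarrow> ('a::cbanach \<Rightarrow>\<^sub>L 'a)"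
  assumes G: "G \<in> op_distributions_0" and "compact K" "e > 0"
  shows "nhd_in_D_on K {\<phi> \<in> \<D>. norm (G \<phi>) < e}"
\<comment> \<open>The case split yields the zero test function as a trivial linear combination of
  any given one.\<close>
proof (cases "\<D> = {}")
  case True
  then show ?thesis by (auto simp: nhd_in_D_on_def intro: exI[of _ 1])
next
  case False
  then have zero: "(\<lambda>_. 0) \<in> \<D>" using test_functions_lincomb[of _ _ 0 0] by auto
  have add: "G (\<lambda>t. \<phi> t + \<psi> t) = G \<phi> + G \<psi>" if "\<phi> \<in> \<D>" "\<psi> \<in> \<D>" for \<phi> \<psi>
    using G that by (simp add: op_distributions_0_def)
  have "G (\<lambda>_. 0) = 0" using add[OF zero zero] by simp
  moreover have "openin test_topology {\<phi> \<in> topspace test_topology. G \<phi> \<in> ball 0 e}"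
    using G unfolding op_distributions_0_def by (intro openin_continuous_map_preimage[of _ euclidean]) auto
  ultimately obtain U where U: "basic_zero_nhd U"
    "\<And>\<psi>. \<psi> \<in> U \<Longrightarrow> (\<lambda>t. 0 + \<psi> t) \<in> {\<phi> \<in> \<D>. G \<phi> \<in> ball 0 e}"
    using zero \<open>e > 0\<close> unfolding openin_test_topology topspace_test_topology
    by (elim conjE ballE[where x = "\<lambda>_. 0"]) auto
  then have "U \<subseteq> {\<phi> \<in> \<D>. norm (G \<phi>) < e}" by auto
  moreover have "nhd_in_D_on K U"
    using U(1) \<open>compact K\<close> by (simp add: basic_zero_nhd_def)
  ultimately show ?thesis unfolding nhd_in_D_on_def by blast
qed

lemma has_vector_derivative_test_function:
  assumes "\<phi> \<in> \<D>"
  shows "((derivative ^^ n) \<phi> has_vector_derivative (derivative ^^ Suc n) \<phi> t) (at t within I)"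
  using derivative_works[OF test_functions_differentiable[OF test_functions_derivative_funpow[OF assms]]]
  by (simp add: has_vector_derivative_at_within)

text \<open>The mean value inequality is used twice: the derivative of order n + 1 varies by at most
  M|h| on the segment, which bounds the linearization error. Being quadratic in h, the bound
  survives division by h, uniformly in t.\<close>

lemma test_function_linearization:
  assumes "\<phi> \<in> \<D>" and M: "\<And>s. norm ((derivative ^^ Suc (Suc n)) \<phi> s) \<le> M"
  shows "norm ((derivative ^^ n) \<phi> (t - h) - (derivative ^^ n) \<phi> t + h *\<^sub>R (derivative ^^ Suc n) \<phi> t)
    \<le> \<bar>h\<bar> * (M * \<bar>h\<bar>)"
proof -
  note der = has_vector_derivative_test_function[OF assms(1)]
  have lip: "norm ((derivative ^^ Suc n) \<phi> s - (derivative ^^ Suc n) \<phi> t) \<le> M * \<bar>h\<bar>"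
    if "s \<in> closed_segment t (t - h)" for s
  proof -
    have "norm ((derivative ^^ Suc n) \<phi> s - (derivative ^^ Suc n) \<phi> t) \<le> M * norm (s - t)"
    proof (rule differentiable_bound[OF convex_UNIV])
      show "((derivative ^^ Suc n) \<phi> has_derivative (\<lambda>y. y *\<^sub>R (derivative ^^ Suc (Suc n)) \<phi> r)) (at r)" for r
        using der[of "Suc n" r UNIV] unfolding has_vector_derivative_def .
      show "onorm (\<lambda>y. y *\<^sub>R (derivative ^^ Suc (Suc n)) \<phi> r) \<le> M" for r
      proof (rule onorm_bound)
        show "0 \<le> M" using M[of 0] norm_ge_zero order_trans by blast
        show "norm (y *\<^sub>R (derivative ^^ Suc (Suc n)) \<phi> r) \<le> M * norm y" for y
          using mult_left_mono[OF M, of "\<bar>y\<bar>" r] by (simp add: mult.commute)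
      qed
    qed auto
    also have "\<dots> \<le> M * \<bar>h\<bar>"
    proof (rule mult_left_mono)
      show "norm (s - t) \<le> \<bar>h\<bar>"
        using segment_bound(1)[OF that] by simp
      show "0 \<le> M" using M[of 0] norm_ge_zero order_trans by blast
    qed
    finally show ?thesis .
  qed
  have "norm ((derivative ^^ n) \<phi> (t - h) - (derivative ^^ n) \<phi> t - (t - h - t) *\<^sub>R (derivative ^^ Suc n) \<phi> t)
      \<le> norm (t - h - t) * (M * \<bar>h\<bar>)"
    by (rule vector_differentiable_bound_linearization[OF der order_refl lip ends_in_segment(1)])
  then show ?thesis by simp
qed

text \<open>The difference quotients of r \<mapsto> \<phi>(t - r) converge to -\<phi>'(t - r)
  together with all t-derivatives, uniformly and with supports in one compact set. Continuity of
  \<open>G\<close> turns this into convergence in operator norm.\<close>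

lemma distribution_translation_has_vector_derivative:
  fixes G :: "(real \<Rightarrow> complex) \<Rightarrow> ('a::cbanach \<Rightarrow>\<^sub>L 'a)"
  assumes G: "G \<in> op_distributions_0" and \<phi>: "\<phi> \<in> \<D>"
  shows "((\<lambda>r. G (\<lambda>t. \<phi> (t - r))) has_vector_derivative - G (\<lambda>t. derivative \<phi> (t - r))) (at r within I)"
proof (rule has_vector_derivative_at_within)
  have Gadd: "G (\<lambda>t. \<phi> t + \<psi> t) = G \<phi> + G \<psi>" if "\<phi> \<in> \<D>" "\<psi> \<in> \<D>" for \<phi> \<psi>
    using G that by (simp add: op_distributions_0_def)
  have Gscale: "G (\<lambda>t. complex_of_real c * \<phi> t) = c *\<^sub>R G \<phi>" if "\<phi> \<in> \<D>" for \<phi> c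
    using G that by (intro blinfun_eqI) (simp add: op_distributions_0_def scaleR_blinfun.rep_eq scaleR_scaleC)
  \<comment> \<open>The error of the difference quotient; the derivative enters with a plus sign
    because the limit is its negative. The factors 1 and -1 put it into the shape of the linear
    combination lemmas.\<close>
  define quot where "quot h = (\<lambda>t. complex_of_real (inverse h) * (1 * \<phi> (t - (r + h)) + (- 1) * \<phi> (t - r))
      + 1 * derivative \<phi> (t - r))" for h
  note shift = test_functions_shift[OF \<phi>] test_functions_shift[OF test_functions_derivative[OF \<phi>]]
  have quot_D: "quot h \<in> \<D>" for h
    unfolding quot_def by (intro test_functions_lincomb shift)
  have G_quot: "G (quot h) = (G (\<lambda>t. \<phi> (t - (r + h))) - G (\<lambda>t. \<phi> (t - r))) /\<^sub>R h + G (\<lambda>t. derivative \<phi> (t - r))" for h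
  proof -
    have 1: "(\<lambda>t. 1 * \<phi> (t - (r + h)) + (- 1) * \<phi> (t - r)) \<in> \<D>"
      by (intro test_functions_lincomb shift)
    have 2: "(\<lambda>t. - 1 * \<phi> (t - r)) \<in> \<D>"
      using test_functions_lincomb[OF shift(1) shift(1), of "- 1" r 0 r] by simp
    have "G (\<lambda>t. - 1 * \<phi> (t - r)) = - G (\<lambda>t. \<phi> (t - r))"
      using Gscale[OF shift(1), of "- 1" r] by simp
    then have "G (\<lambda>t. 1 * \<phi> (t - (r + h)) + (- 1) * \<phi> (t - r)) = G (\<lambda>t. \<phi> (t - (r + h))) - G (\<lambda>t. \<phi> (t - r))"
      using Gadd[OF shift(1)[of "r + h"] 2] by simp
    moreover have "(\<lambda>t. complex_of_real (inverse h) * (1 * \<phi> (t - (r + h)) + (- 1) * \<phi> (t - r))) \<in> \<D>"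
      using test_functions_lincomb[OF 1 1, of "complex_of_real (inverse h)" 0] by simp
    ultimately show ?thesis
      unfolding quot_def using Gadd[OF _ shift(2)] Gscale[OF 1, of "inverse h"] by simp
  qed
  \<comment> \<open>Each derivative of the error is the linearization remainder of the same
    derivative of \<phi>, divided by h.\<close>
  have quot_deriv: "(derivative ^^ n) (quot h) t = ((derivative ^^ n) \<phi> (t - r - h) - (derivative ^^ n) \<phi> (t - r)
      + h *\<^sub>R (derivative ^^ Suc n) \<phi> (t - r)) /\<^sub>R h" if "h \<noteq> 0" for n h t
  proof -
    have sm: "smooth (\<lambda>t. \<phi> (t - s))" "smooth (\<lambda>t. derivative \<phi> (t - s))" for s
      using shift by (simp_all add: test_functions_def)
    have sm2: "smooth (\<lambda>t. 1 * \<phi> (t - (r + h)) + (- 1) * \<phi> (t - r))"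
      using test_functions_lincomb[OF shift(1) shift(1)] unfolding test_functions_def by blast
    have sm\<phi>: "smooth \<phi>" "smooth (derivative \<phi>)"
      using \<phi> test_functions_derivative[OF \<phi>] by (simp_all add: test_functions_def)
    have "(derivative ^^ n) (derivative \<phi>) = (derivative ^^ Suc n) \<phi>"
      by (simp add: funpow_swap1)
    then have "(derivative ^^ n) (quot h) t = complex_of_real (inverse h) *
        ((derivative ^^ n) \<phi> (t - (r + h)) - (derivative ^^ n) \<phi> (t - r)) + (derivative ^^ Suc n) \<phi> (t - r)"
      unfolding quot_def derivative_funpow_lincomb[OF sm2 sm(2)] derivative_funpow_lincomb[OF sm(1) sm(1)]
        derivative_funpow_shift[OF sm\<phi>(1)] derivative_funpow_shift[OF sm\<phi>(2)] by simp
    then show ?thesis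
      using that by (simp add: scaleR_conv_of_real algebra_simps)
  qed
  obtain b where b: "supp \<phi> \<subseteq> {- b..b}"
  proof -
    have "bounded (supp \<phi>)" using \<phi> by (simp add: test_functions_def compact_imp_bounded)
    then obtain b where "\<And>x. x \<in> supp \<phi> \<Longrightarrow> \<bar>x\<bar> \<le> b" unfolding bounded_iff by auto
    then show ?thesis using that[of b] by fastforce
  qed
  \<comment> \<open>The margin 1 absorbs the extra shift for |h| \<le> 1, so one compact set serves
    all these h.\<close>
  let ?K = "{- b + r - 1..b + r + 1}"
  have supp_quot: "supp (quot h) \<subseteq> ?K" if "\<bar>h\<bar> \<le> 1" for h
  proof -
    have "quot h t = 0" if "t \<notin> ?K" for t
    proof -
      have "t - (r + h) \<notin> supp \<phi>" "t - r \<notin> supp \<phi>"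
        using b that \<open>\<bar>h\<bar> \<le> 1\<close> by (auto dest!: subsetD)
      then show ?thesis
        unfolding quot_def by (simp add: eq_0_outside_supp derivative_eq_0_outside_supp)
    qed
    then have "{t. quot h t \<noteq> 0} \<subseteq> ?K" by blast
    then show ?thesis
      unfolding supp_def by (simp add: closure_minimal)
  qed
  have small: "\<forall>\<^sub>F h in at 0. norm (G (quot h)) < e" if e: "e > 0" for e
  proof -
    have "nhd_in_D_on ?K {\<psi> \<in> \<D>. norm (G \<psi>) < e}"
      by (rule op_distribution_bounded_on[OF G compact_Icc e])
    then obtain N \<epsilon> where "\<epsilon> > 0" and N: "\<forall>\<psi>\<in>\<D>. supp \<psi> \<subseteq> ?K \<longrightarrow>
        (\<forall>n\<le>N. \<forall>t. cmod ((derivative ^^ n) \<psi> t) \<le> \<epsilon>) \<longrightarrow> \<psi> \<in> {\<psi> \<in> \<D>. norm (G \<psi>) < e}"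
      unfolding nhd_in_D_on_def by (elim exE conjE)
    have "\<forall>\<^sub>F h in at 0. \<forall>t. cmod ((derivative ^^ n) (quot h) t) \<le> \<epsilon>" for n
    proof -
      obtain M where M: "\<And>s. norm ((derivative ^^ Suc (Suc n)) \<phi> s) \<le> M"
        using test_functions_bounded[OF test_functions_derivative_funpow[OF \<phi>]] by blast
      have "((\<lambda>h. M * \<bar>h\<bar>) \<longlongrightarrow> M * \<bar>0\<bar>) (at 0)"
        by (intro tendsto_intros)
      then have "\<forall>\<^sub>F h in at 0. M * \<bar>h\<bar> < \<epsilon>"
        using \<open>\<epsilon> > 0\<close> by (intro order_tendstoD(2)) auto
      moreover have "\<forall>\<^sub>F h in at 0. h \<noteq> (0 :: real)"
        by (simp add: eventually_at_filter)
      ultimately show ?thesis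
      proof eventually_elim
        case (elim h)
        show ?case
        proof
          fix t
          have "cmod ((derivative ^^ n) (quot h) t) \<le> (\<bar>h\<bar> * (M * \<bar>h\<bar>)) / \<bar>h\<bar>"
            unfolding quot_deriv[OF elim(2)] norm_scaleR
            using divide_right_mono[OF test_function_linearization[OF \<phi> M, of "t - r" h], of "\<bar>h\<bar>"]
            by (simp add: divide_inverse mult.commute)
          then show "cmod ((derivative ^^ n) (quot h) t) \<le> \<epsilon>"
            using elim by simp
        qed
      qed
    qed
    then have "\<forall>\<^sub>F h in at 0. \<forall>n\<in>{..N}. \<forall>t. cmod ((derivative ^^ n) (quot h) t) \<le> \<epsilon>"
      by (intro eventually_ball_finite) auto
    moreover have "\<forall>\<^sub>F h in at 0. \<bar>h\<bar> \<le> (1 :: real)"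
      unfolding eventually_at by (intro exI[of _ 1]) (simp add: dist_norm)
    ultimately show ?thesis
    proof eventually_elim
      case (elim h)
      then show ?case using N quot_D supp_quot by simp
    qed
  qed
  have "((\<lambda>h. G (quot h)) \<longlongrightarrow> 0) (at 0)"
    using small by (simp add: tendsto_iff dist_norm)
  then have lim: "((\<lambda>h. norm (G (quot h))) \<longlongrightarrow> 0) (at 0)"
    by (rule tendsto_norm_zero)
  \<comment> \<open>This is exactly the quotient in the definition of the derivative, so its limit
    is already known.\<close>
  have "norm (G (quot h)) = norm (G (\<lambda>t. \<phi> (t - (r + h))) - G (\<lambda>t. \<phi> (t - r))
      - h *\<^sub>R - G (\<lambda>t. derivative \<phi> (t - r))) / norm h" if "h \<noteq> 0" for h
  proof -
    have "G (quot h) = (G (\<lambda>t. \<phi> (t - (r + h))) - G (\<lambda>t. \<phi> (t - r))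
      - h *\<^sub>R - G (\<lambda>t. derivative \<phi> (t - r))) /\<^sub>R h"
      unfolding G_quot using that by (simp add: scaleR_add_right)
    then show ?thesis by (simp add: divide_inverse mult.commute)
  qed
  then have "((\<lambda>h. norm (G (\<lambda>t. \<phi> (t - (r + h))) - G (\<lambda>t. \<phi> (t - r))
      - h *\<^sub>R - G (\<lambda>t. derivative \<phi> (t - r))) / norm h) \<longlongrightarrow> 0) (at 0)"
    by (intro Lim_transform_eventually[OF lim]) (auto simp: eventually_at_filter)
  then show "((\<lambda>r. G (\<lambda>t. \<phi> (t - r))) has_vector_derivative - G (\<lambda>t. derivative \<phi> (t - r))) (at r)"
    unfolding has_vector_derivative_def has_derivative_at
    by (intro conjI bounded_linear_scaleR_left)
qed

section \<open>Mild solutions\<close>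

text \<open>The condition under the existential quantifier of \<open>solution_space\<close>, named
  so that the initial value and the solution can be translated together.\<close>

definition mild_solution :: "('a::banach \<times> 'a) set \<Rightarrow> 'a \<Rightarrow> (real \<Rightarrow> 'a) \<Rightarrow> bool" where
  "mild_solution A x u \<longleftrightarrow> continuous_on {0..} u \<and> (\<forall>t\<ge>0. (integral {0..t} u, u t - x) \<in> A)"

lemma solution_space_iff: "x \<in> solution_space A \<longleftrightarrow> (\<exists>u. mild_solution A x u)"
  by (simp add: solution_space_def mild_solution_def)

text \<open>Subtracting the graph elements for \<open>b\<close> and \<open>a\<close> cancels the
  initial value, so the relation becomes invariant under translation of time.\<close>

lemma mild_solution_subinterval:
  assumes "mild_solution A x u" "subspace A" "0 \<le> a" "a \<le> b"
  shows "(integral {a..b} u, u b - u a) \<in> A"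
proof -
  have "u integrable_on {0..b}"
    using assms(1) unfolding mild_solution_def
    by (intro integrable_continuous_interval) (auto intro: continuous_on_subset)
  then have "integral {0..a} u + integral {a..b} u = integral {0..b} u"
    using assms(3,4) by (intro Henstock_Kurzweil_Integration.integral_combine)
  moreover have "(integral {0..b} u, u b - x) - (integral {0..a} u, u a - x) \<in> A"
    using assms unfolding mild_solution_def by (intro subspace_diff) auto
  ultimately show ?thesis by (metis add_diff_cancel_left' diff_Pair diff_diff_eq2 diff_add_cancel)
qed

lemma mild_solution_shift:
  assumes "mild_solution A x u" "subspace A" "0 \<le> s"
  shows "mild_solution A (u s) (\<lambda>t. u (t + s))"
  unfolding mild_solution_def
proof (intro conjI allI impI)
  show "continuous_on {0..} (\<lambda>t. u (t + s))"
    using assms unfolding mild_solution_def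
    by (auto intro!: continuous_intros intro: continuous_on_compose2[of "{0..}" u])
  fix t :: real assume "t \<ge> 0"
  then show "(integral {0..t} (\<lambda>t. u (t + s)), u (t + s) - u s) \<in> A"
    using mild_solution_subinterval[OF assms, of "t + s"] integral_shift_real_ivl[of s s "t + s" u] by simp
qed

text \<open>For negative s the function \<open>f\<close> is not given by \<open>u\<close> near s,
  but \<open>f (t + s + \<tau> n)\<close> is once \<open>\<tau> n + s \<ge> 0\<close>. Those
  translates are mild solutions, and both entries of the graph relation converge.\<close>

lemma mild_solution_translation_limit:
  fixes f :: "real \<Rightarrow> 'a::banach"
  assumes u: "mild_solution A x u" and A: "subspace A" "closed A"
    and f: "almost_periodic_on UNIV f" "\<And>t. t \<ge> 0 \<Longrightarrow> f t = u t"
  shows "mild_solution A (f s) (\<lambda>t. f (t + s))"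
  unfolding mild_solution_def
proof (intro conjI allI impI)
  have cont: "continuous_on UNIV f"
    using f(1) by (simp add: almost_periodic_on_def)
  then show "continuous_on {0..} (\<lambda>t. f (t + s))"
    by (auto intro!: continuous_intros intro: continuous_on_compose2)
  obtain \<tau> :: "nat \<Rightarrow> real" where \<tau>: "\<And>n. \<tau> n \<ge> real n"
    "\<And>n t. t \<in> UNIV \<Longrightarrow> norm (f (t + \<tau> n) - f t) \<le> inverse (real (Suc n))"
    using almost_periods_sequence[OF f(1)] by auto
  note lim = tendsto_of_almost_periods[OF \<tau>(2) UNIV_I]
  fix t :: real assume t: "t \<ge> 0"
  have integ: "(\<lambda>t. f (t + r)) integrable_on {a..b}" for r a b
    using cont by (intro integrable_continuous_interval continuous_on_compose2[OF cont]) (auto intro!: continuous_intros)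
  \<comment> \<open>The almost period estimate is uniform in the integration variable, so the
    integrals differ by at most t/(n+1).\<close>
  have "(\<lambda>n. integral {0..t} (\<lambda>r. f (r + (\<tau> n + s)))) \<longlonglongrightarrow> integral {0..t} (\<lambda>r. f (r + s))"
  proof (rule LIM_zero_cancel, rule Lim_null_comparison)
    show "\<forall>\<^sub>F n in sequentially. norm (integral {0..t} (\<lambda>r. f (r + (\<tau> n + s))) - integral {0..t} (\<lambda>r. f (r + s)))
        \<le> t * inverse (real (Suc n))"
    proof (intro always_eventually allI)
      fix n
      have "integral {0..t} (\<lambda>r. f (r + (\<tau> n + s))) - integral {0..t} (\<lambda>r. f (r + s))
          = integral {0..t} (\<lambda>r. f (r + (\<tau> n + s)) - f (r + s))"
        by (rule integral_diff[symmetric, OF integ integ])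
      also have "norm \<dots> \<le> inverse (real (Suc n)) * (t - 0)"
      proof (rule integral_bound[OF t])
        show "continuous_on {0..t} (\<lambda>r. f (r + (\<tau> n + s)) - f (r + s))"
          by (intro continuous_intros continuous_on_compose2[OF cont]) auto
        show "norm (f (r + (\<tau> n + s)) - f (r + s)) \<le> inverse (real (Suc n))" for r
          using \<tau>(2)[of "r + s" n] by (simp add: ac_simps)
      qed
      finally show "norm (integral {0..t} (\<lambda>r. f (r + (\<tau> n + s))) - integral {0..t} (\<lambda>r. f (r + s)))
        \<le> t * inverse (real (Suc n))" by (simp add: mult.commute)
    qed
    show "(\<lambda>n. t * inverse (real (Suc n))) \<longlonglongrightarrow> 0"
      by (intro tendsto_mult_right_zero LIMSEQ_inverse_real_of_nat)
  qed
  then have lim_pair: "(\<lambda>n. (integral {0..t} (\<lambda>r. f (r + (\<tau> n + s))), f (t + s + \<tau> n) - f (s + \<tau> n)))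
      \<longlonglongrightarrow> (integral {0..t} (\<lambda>r. f (r + s)), f (t + s) - f s)"
    by (intro tendsto_intros lim)
  have "\<forall>\<^sub>F n in sequentially.
    (integral {0..t} (\<lambda>r. f (r + (\<tau> n + s))), f (t + s + \<tau> n) - f (s + \<tau> n)) \<in> A"
  proof -
    obtain N where N: "- s \<le> real N" using real_arch_simple by blast
    show ?thesis
      using eventually_ge_at_top[of N]
    proof eventually_elim
      case (elim n)
      then have pos: "\<tau> n + s \<ge> 0"
        using N \<tau>(1)[of n] by (smt (verit) of_nat_mono)
      have "integral {0..t} (\<lambda>r. f (r + (\<tau> n + s))) = integral {0..t} (\<lambda>r. u (r + (\<tau> n + s)))"
        using pos by (intro integral_cong) (auto intro!: f(2))
      moreover have "f (t + s + \<tau> n) = u (t + (\<tau> n + s))" "f (s + \<tau> n) = u (\<tau> n + s)"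
        using pos t f(2)[of "t + (\<tau> n + s)"] f(2)[of "\<tau> n + s"] by (simp_all add: ac_simps)
      ultimately show ?case
        using mild_solution_shift[OF u A(1) pos] t unfolding mild_solution_def by simp
    qed
  qed
  then show "(integral {0..t} (\<lambda>t. f (t + s)), f (t + s) - f s) \<in> A"
    by (rule Lim_in_closed_set[OF A(2) _ trivial_limit_sequentially lim_pair])
qed

text \<open>Values at negative times are limits of values at nonnegative times. This will show that
  \<open>S s\<close> maps into a closed \<open>V\<close> when the forward orbit stays in
  \<open>V\<close>.\<close>

lemma almost_periodic_mem_closed:
  assumes f: "almost_periodic_on UNIV f" and "closed V" "\<And>t. t \<ge> 0 \<Longrightarrow> f t \<in> V"
  shows "f s \<in> V"
proof -
  obtain \<tau> :: "nat \<Rightarrow> real" where \<tau>: "\<And>n. \<tau> n \<ge> real n"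
    "\<And>n t. t \<in> UNIV \<Longrightarrow> norm (f (t + \<tau> n) - f t) \<le> inverse (real (Suc n))"
    using almost_periods_sequence[OF f] by auto
  obtain N where N: "- s \<le> real N" using real_arch_simple by blast
  have "s + \<tau> n \<ge> 0" if "n \<ge> N" for n
    using N \<tau>(1)[of n] that by (smt (verit) of_nat_mono)
  then have "\<forall>\<^sub>F n in sequentially. f (s + \<tau> n) \<in> V"
    using assms(3) by (auto simp: eventually_sequentially)
  then show ?thesis
    using \<open>closed V\<close> tendsto_of_almost_periods[OF \<tau>(2) UNIV_I] Lim_in_closed_set by fastforce
qed

section \<open>The generator as a closed linear relation, and its mild solutions\<close>

lemma generator_iff:
  "(x, y) \<in> generator G \<longleftrightarrow> (\<forall>\<phi>\<in>\<D>\<^sub>0. blinfun_apply (G (\<lambda>t. - derivative \<phi> t)) x = blinfun_apply (G \<phi>) y)"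
  unfolding generator_def dist_op_def
  by (simp add: dist_conv_minus_dirac_deriv test_functions_0_subset)

lemma subspace_generator: "subspace (generator G)"
  unfolding subspace_def zero_prod_def
  by (auto simp: generator_iff blinfun.bilinear_simps)

text \<open>Each test function contributes an equation between two bounded operators, hence a closed
  condition on pairs.\<close>

lemma closed_generator: "closed (generator G)"
proof -
  have "generator G = (\<Inter>\<phi>\<in>\<D>\<^sub>0. {z. blinfun_apply (G (\<lambda>t. - derivative \<phi> t)) (fst z) = blinfun_apply (G \<phi>) (snd z)})"
    by (auto simp: generator_iff)
  also have "closed \<dots>"
    by (intro closed_INT ballI closed_Collect_eq continuous_intros)
  finally show ?thesis .
qed

lemma distribution_uminus:
  fixes G :: "(real \<Rightarrow> complex) \<Rightarrow> ('a::cbanach \<Rightarrow>\<^sub>L 'a)"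
  assumes "G \<in> op_distributions_0" "\<phi> \<in> \<D>"
  shows "G (\<lambda>t. - \<phi> t) = - G \<phi>"
proof (rule blinfun_eqI)
  fix x
  have "blinfun_apply (G (\<lambda>t. (- 1) * \<phi> t)) x = (- 1) *\<^sub>C blinfun_apply (G \<phi>) x"
    using assms unfolding op_distributions_0_def by blast
  also have "\<dots> = (- 1) *\<^sub>R blinfun_apply (G \<phi>) x"
    by (simp only: scaleR_scaleC) simp
  finally show "blinfun_apply (G (\<lambda>t. - \<phi> t)) x = blinfun_apply (- G \<phi>) x"
    by (simp add: uminus_blinfun.rep_eq)
qed

lemma generator_derivative:
  assumes "G \<in> op_distributions_0" "(x, y) \<in> generator G" "\<phi> \<in> \<D>\<^sub>0"
  shows "blinfun_apply (G (derivative \<phi>)) x = - blinfun_apply (G \<phi>) y"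
proof -
  have "blinfun_apply (G (\<lambda>t. - derivative \<phi> t)) x = blinfun_apply (G \<phi>) y"
    using assms(2,3) by (simp add: generator_iff)
  then show ?thesis
    using distribution_uminus[OF assms(1) test_functions_derivative[OF test_functions_0_subset[OF assms(3)]]]
    by (metis minus_minus uminus_blinfun.rep_eq)
qed

text \<open>\<open>\<lambda>s. G(\<phi>(\<cdot> - (t - s))) (\<integral>\<^sub>0\<^sup>s u) + \<integral>\<^sub>0\<^sup>t\<^sup>-\<^sup>s G(\<phi>(\<cdot> - r)) x dr\<close> is constant on \<open>[0, t]\<close>.\<close>

lemma distribution_integral_mild_solution:
  fixes G :: "(real \<Rightarrow> complex) \<Rightarrow> ('a::cbanach \<Rightarrow>\<^sub>L 'a)"
  assumes G: "G \<in> op_distributions_0" and u: "mild_solution (generator G) x u"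
    and \<phi>: "\<phi> \<in> \<D>\<^sub>0" and t: "t \<ge> 0"
  shows "blinfun_apply (G \<phi>) (integral {0..t} u) = integral {0..t} (\<lambda>r. blinfun_apply (G (\<lambda>s. \<phi> (s - r))) x)"
proof -
  define g where "g r = G (\<lambda>s. \<phi> (s - r))" for r
  define g' where "g' r = G (\<lambda>s. derivative \<phi> (s - r))" for r
  define U where "U s = integral {0..s} u" for s
  define W where "W r = integral {0..r} (\<lambda>r. blinfun_apply (g r) x)" for r
  note \<phi>D = test_functions_0_subset[OF \<phi>]
  have g: "(g has_vector_derivative - g' r) (at r within I)" for r I
    unfolding g_def g'_def by (rule distribution_translation_has_vector_derivative[OF G \<phi>D])
  have g_cont: "continuous_on {0..t} (\<lambda>r. blinfun_apply (g r) x)"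
    by (intro continuous_intros continuous_on_vector_derivative[OF g])
  \<comment> \<open>The generator relation is tested against the translate of \<phi> by r, which
    stays in \<open>\<D>\<^sub>0\<close> because r \<ge> 0.\<close>
  have g'_U: "blinfun_apply (g' r) (U s) = - blinfun_apply (g r) (u s - x)" if "r \<ge> 0" "s \<ge> 0" for r s
  proof -
    have "(U s, u s - x) \<in> generator G"
      using u that by (simp add: mild_solution_def U_def)
    from generator_derivative[OF G this test_functions_0_shift[OF \<phi> \<open>r \<ge> 0\<close>]] show ?thesis
      unfolding g_def g'_def derivative_shift[OF test_functions_differentiable[OF \<phi>D]] .
  qed
  \<comment> \<open>The product rule gives g(t - s)(u s) + g'(t - s)(U s) - g(t - s)x, and
    \<open>g'_U\<close> makes the three terms cancel.\<close>
  have "((\<lambda>s. blinfun_apply (g (t - s)) (U s) + W (t - s)) has_vector_derivative 0) (at s within {0..t})"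
    if s: "s \<in> {0..t}" for s
  proof -
    have im: "(\<lambda>s. t - s) ` {0..t} = {0..t}"
      using image_diff_atLeastAtMost[of t 0 t] t by simp
    have refl: "((\<lambda>s. t - s) has_vector_derivative - 1) (at s within {0..t})"
      by (auto intro!: derivative_eq_intros)
    have "((\<lambda>s. g (t - s)) has_vector_derivative g' (t - s)) (at s within {0..t})"
      using vector_diff_chain_within[OF refl g] by (simp add: o_def)
    moreover have "(U has_vector_derivative u s) (at s within {0..t})"
      unfolding U_def using u s unfolding mild_solution_def
      by (intro integral_has_vector_derivative) (auto intro: continuous_on_subset)
    ultimately have "((\<lambda>s. blinfun_apply (g (t - s)) (U s)) has_vector_derivative
        blinfun_apply (g (t - s)) (u s) + blinfun_apply (g' (t - s)) (U s)) (at s within {0..t})"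
      by (rule bounded_bilinear.has_vector_derivative[OF bounded_bilinear_blinfun_apply])
    moreover have "(W has_vector_derivative blinfun_apply (g (t - s)) x) (at (t - s) within {0..t})"
      unfolding W_def using s by (intro integral_has_vector_derivative[OF g_cont]) auto
    then have "((\<lambda>s. W (t - s)) has_vector_derivative - blinfun_apply (g (t - s)) x) (at s within {0..t})"
      using vector_diff_chain_within[OF refl, of W] im by (simp add: o_def)
    ultimately have "((\<lambda>s. blinfun_apply (g (t - s)) (U s) + W (t - s)) has_vector_derivative
        (blinfun_apply (g (t - s)) (u s) + blinfun_apply (g' (t - s)) (U s)) + - blinfun_apply (g (t - s)) x)
        (at s within {0..t})"
      by (rule has_vector_derivative_add)
    then show ?thesis
      using g'_U[of "t - s" s] s by (simp add: blinfun.diff_right)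
  qed
  then obtain c where "\<And>s. s \<in> {0..t} \<Longrightarrow> blinfun_apply (g (t - s)) (U s) + W (t - s) = c"
    using has_vector_derivative_zero_constant[OF convex_real_interval(5)] by blast
  from this[of 0] this[of t] have "blinfun_apply (g t) (U 0) + W t = blinfun_apply (g 0) (U t) + W 0"
    using t by simp
  then show ?thesis
    by (simp add: U_def W_def g_def)
qed

text \<open>Differentiating both sides of the integral identity in t yields the defining relation of
  \<open>dist_op G (dirac t)\<close>.\<close>

lemma mild_solution_dirac:
  fixes G :: "(real \<Rightarrow> complex) \<Rightarrow> ('a::cbanach \<Rightarrow>\<^sub>L 'a)"
  assumes G: "G \<in> op_distributions_0" and u: "mild_solution (generator G) x u" and t: "t \<ge> 0"
  shows "(x, u t) \<in> dist_op G (dirac t)"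
proof -
  have "blinfun_apply (G (\<lambda>s. \<phi> (s - t))) x = blinfun_apply (G \<phi>) (u t)" if \<phi>: "\<phi> \<in> \<D>\<^sub>0" for \<phi>
  \<comment> \<open>The right endpoint t + 1 keeps the interval nondegenerate at t = 0; derivatives
    there are one-sided but still unique.\<close>
  proof (rule vector_derivative_unique_within_closed_interval[of 0 "t + 1" t])
    have u_cont: "continuous_on {0..t + 1} u"
      using u unfolding mild_solution_def by (auto intro: continuous_on_subset)
    show "((\<lambda>t. blinfun_apply (G \<phi>) (integral {0..t} u)) has_vector_derivative blinfun_apply (G \<phi>) (u t))
        (at t within cbox 0 (t + 1))"
      using t by (intro bounded_linear.has_vector_derivative[OF blinfun.bounded_linear_right])
        (auto intro!: integral_has_vector_derivative[OF u_cont])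
    have "continuous_on {0..t + 1} (\<lambda>r. blinfun_apply (G (\<lambda>s. \<phi> (s - r))) x)"
      by (intro continuous_intros continuous_on_vector_derivative
          [OF distribution_translation_has_vector_derivative[OF G test_functions_0_subset[OF \<phi>]]])
    then have "((\<lambda>t. integral {0..t} (\<lambda>r. blinfun_apply (G (\<lambda>s. \<phi> (s - r))) x)) has_vector_derivative
        blinfun_apply (G (\<lambda>s. \<phi> (s - t))) x) (at t within {0..t + 1})"
      using t by (intro integral_has_vector_derivative) auto
    then show "((\<lambda>t. blinfun_apply (G \<phi>) (integral {0..t} u)) has_vector_derivative
        blinfun_apply (G (\<lambda>s. \<phi> (s - t))) x) (at t within cbox 0 (t + 1))"
      using distribution_integral_mild_solution[OF G u \<phi>] t
      by (auto intro: has_vector_derivative_transform[rotated 2])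
  qed (use t in auto)
  then show ?thesis
    by (simp add: dist_op_def dist_conv_dirac)
qed

text \<open>The operators \<open>G \<phi>\<close> with \<phi> in \<open>\<D>\<^sub>0\<close> have
  trivial common kernel, so the relation is single-valued and the definite description picks
  \<open>u t\<close>.\<close>

lemma op_app_mild_solution:
  fixes G :: "(real \<Rightarrow> complex) \<Rightarrow> ('a::cbanach \<Rightarrow>\<^sub>L 'a)"
  assumes "C_distribution_semigroup C G" "mild_solution (generator G) x u" "t \<ge> 0"
  shows "op_app (dist_op G (dirac t)) x = u t"
  unfolding op_app_def
proof (rule the_equality)
  show mem: "(x, u t) \<in> dist_op G (dirac t)"
    using assms(1) mild_solution_dirac[OF _ assms(2,3)] by (simp add: C_distribution_semigroup_def)
  fix y assume "(x, y) \<in> dist_op G (dirac t)"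
  with mem have "blinfun_apply (G \<phi>) (y - u t) = 0" if "\<phi> \<in> \<D>\<^sub>0" for \<phi>
    using that by (simp add: dist_op_def blinfun.diff_right)
  then have "y - u t \<in> (\<Inter>\<phi>\<in>\<D>\<^sub>0. {x. blinfun_apply (G \<phi>) x = 0})" by blast
  also have "\<dots> = {0}"
    using assms(1) by (simp only: C_distribution_semigroup_def)
  finally show "y = u t" by simp
qed

section \<open>Composition laws for \<open>T\<close> and \<open>S\<close>\<close>

theorem proposition2p4:
  fixes C :: "'a::cbanach \<Rightarrow>\<^sub>L 'a"
    and G :: "(real \<Rightarrow> complex) \<Rightarrow> ('a \<Rightarrow>\<^sub>L 'a)"
    and A :: "('a \<times> 'a) set"
    and V :: "'a set"
    and T S :: "real \<Rightarrow> 'a \<Rightarrow> 'a"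
  assumes "C \<in> clinear_ops" and "inj (blinfun_apply C)"
    and "C_distribution_semigroup C G"
    and "A = generator G"
    and "csubspace V" and "V \<subseteq> solution_space A"
    and "semigroup_almost_periodic G V"
    and "\<And>t x. \<lbrakk>t \<ge> 0; x \<in> solution_space A\<rbrakk> \<Longrightarrow> T t x = op_app (dist_op G (dirac t)) x"
    and "\<And>t x. x \<in> V \<Longrightarrow> S t x = ap_extension (\<lambda>r. T r x) t"
  shows "(\<forall>t\<ge>0. \<forall>s\<ge>0. \<forall>x\<in>solution_space A. T t (T s x) = T (t + s) x) \<and>
    (\<forall>t\<ge>0. \<forall>s\<le>0. \<forall>x\<in>V. op_app (dist_op G (dirac t)) x \<in> V \<longrightarrow>
       S s (S t x) = S (t + s) x) \<and>
    (\<forall>t\<ge>0. \<forall>s\<le>0. \<forall>x\<in>V. S s x \<in> solution_space A \<and> T t (S s x) = S (t + s) x) \<and>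
    (\<forall>t\<ge>0. \<forall>s\<le>0. \<forall>x\<in>V. (\<forall>r\<ge>0. op_app (dist_op G (dirac r)) x \<in> V) \<longrightarrow> closed V \<longrightarrow>
       S s x \<in> V \<and> S t (S s x) = S (t + s) x) \<and>
    (\<forall>t\<le>0. \<forall>s\<le>0. \<forall>x\<in>V. (\<forall>r\<ge>0. op_app (dist_op G (dirac r)) x \<in> V) \<longrightarrow> closed V \<longrightarrow>
       S t (S s x) = S (t + s) x)"
proof -
  note A = \<open>A = generator G\<close> and T = assms(8) and S = assms(9)
  have subsp: "subspace A" and cl: "closed A"
    unfolding A by (fact subspace_generator closed_generator)+
  \<comment> \<open>Any mild solution computes \<open>T\<close>, so each identity for
    \<open>T\<close> below reduces to exhibiting a suitable mild solution.\<close>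
  have T_eq: "T t x = u t" if "mild_solution A x u" "t \<ge> 0" for x u t
  proof -
    have "x \<in> solution_space A" using that(1) solution_space_iff by blast
    then show ?thesis
      using T[of t x] op_app_mild_solution[OF assms(3), of x u t] that A by simp
  qed
  have T_T: "T t (T s x) = T (t + s) x"
    if "t \<ge> 0" "s \<ge> 0" and x: "x \<in> solution_space A" for s t x
  proof -
    obtain u where u: "mild_solution A x u" using x solution_space_iff by blast
    have shift: "mild_solution A (T s x) (\<lambda>r. u (r + s))"
      using mild_solution_shift[OF u subsp \<open>s \<ge> 0\<close>] T_eq[OF u \<open>s \<ge> 0\<close>] by simp
    show ?thesis
      using T_eq[OF shift \<open>t \<ge> 0\<close>] T_eq[OF u, of "t + s"] \<open>t \<ge> 0\<close> \<open>s \<ge> 0\<close> by simp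
  qed
  have V: "x \<in> solution_space A" if "x \<in> V" for x using that assms(6) by blast
  have S_ap: "almost_periodic_on UNIV (\<lambda>t. S t x)" and S_T: "t \<ge> 0 \<Longrightarrow> S t x = T t x"
    if x: "x \<in> V" for x t
  proof -
    have "almost_periodic_on {0..} (\<lambda>r. T r x)"
    proof -
      have "almost_periodic_on {0..} (\<lambda>r. op_app (dist_op G (dirac r)) x)"
        using assms(7) x by (simp add: semigroup_almost_periodic_def)
      then show ?thesis
        by (rule almost_periodic_on_nonneg_cong) (simp add: T V x)
    qed
    note ext = ap_extension[OF this]
    have eq: "(\<lambda>t. S t x) = ap_extension (\<lambda>r. T r x)" using S[OF x] by auto
    show "almost_periodic_on UNIV (\<lambda>t. S t x)" using ext(1) eq by simp
    show "S t x = T t x" if "t \<ge> 0" using ext(2)[OF that] S[OF x] by simp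
  qed
  have S_eqI: "S t y = g t" if "y \<in> V" "almost_periodic_on UNIV g" "\<And>r. r \<ge> 0 \<Longrightarrow> g r = T r y" for y g t
    unfolding S[OF \<open>y \<in> V\<close>] using ap_extension_eqI[of g "\<lambda>r. T r y"] that(2,3) by simp
  \<comment> \<open>The orbit \<open>S\<close> read from time s onwards is a mild solution starting
    at \<open>S s x\<close>; claim (iii) follows from this with \<open>T_eq\<close>.\<close>
  have mild: "mild_solution A (S s x) (\<lambda>t. S (t + s) x)" if x: "x \<in> V" for s x
  proof -
    obtain u where u: "mild_solution A x u" using V[OF x] solution_space_iff by blast
    show ?thesis
      by (rule mild_solution_translation_limit[OF u subsp cl S_ap[OF x]]) (simp add: S_T x T_eq[OF u])
  qed
  have S_mem: "S s x \<in> solution_space A" and T_S: "t \<ge> 0 \<Longrightarrow> T t (S s x) = S (t + s) x" if "x \<in> V" for s t x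
    using mild[OF that] T_eq[OF mild[OF that]] solution_space_iff by blast+
  \<comment> \<open>The translate of \<open>S\<close> by s is almost periodic and by
    \<open>T_S\<close> extends the orbit of \<open>S s x\<close> under \<open>T\<close>, so it is
    the extension. Claims (ii), (iv) and (v) are instances, once \<open>S s x\<close> is known to
    lie in \<open>V\<close>.\<close>
  have S_S: "S t (S s x) = S (t + s) x" if "x \<in> V" "S s x \<in> V" for s t x
    by (rule S_eqI[OF that(2) almost_periodic_on_shift[OF S_ap[OF that(1)]]]) (simp add: T_S that(1))
  have S_V: "S s x \<in> V" if "x \<in> V" "\<forall>r\<ge>0. op_app (dist_op G (dirac r)) x \<in> V" "closed V" for s x
    by (rule almost_periodic_mem_closed[OF S_ap[OF that(1)] that(3)])
       (use that T[OF _ V[OF that(1)]] S_T in simp)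
  show ?thesis
  proof (intro conjI allI impI ballI)
    \<comment> \<open>Here the inner time is t \<ge> 0, so \<open>S t x\<close> equals
      \<open>op_app (dist_op G (dirac t)) x\<close> and lies in \<open>V\<close> by
      assumption.\<close>
    show "S s (S t x) = S (t + s) x"
      if "t \<ge> 0" "s \<le> 0" "x \<in> V" "op_app (dist_op G (dirac t)) x \<in> V" for t s x
      using S_S[of x t s] that S_T[of x t] T[of t x] V by (simp add: add.commute)
    show "T t (T s x) = T (t + s) x" if "t \<ge> 0" "s \<ge> 0" "x \<in> solution_space A" for t s x
      using that by (simp add: T_T)
    show "S s x \<in> solution_space A" "T t (S s x) = S (t + s) x" if "t \<ge> 0" "s \<le> 0" "x \<in> V" for t s x
      using that by (simp_all add: S_mem T_S)
    show "S s x \<in> V" "S t (S s x) = S (t + s) x"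
      if "x \<in> V" "\<forall>r\<ge>0. op_app (dist_op G (dirac r)) x \<in> V" "closed V" for t s x
      using S_V[OF that] S_S[OF that(1)] by blast+
  qed (use S_V S_S in simp)
qed

end
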